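(* Let $n\ge1$ be an integer and $\alpha\ge0$. Let $f=h+\overline{g}\in\mathcal{W}_{\mathcal{H}_n^0}(\alpha)$ with $$h(z)=\sum_{j=1}^n z_j+\sum_{m=2}^\infty\sum_{|\beta|=m}a_\beta z^\beta,\qquad g(z)=\sum_{m=2}^\infty\sum_{|\beta|=m}b_\beta z^\beta .$$ Then for each integer $q\ge2$, the section $S_{1,q}(f)=S_1(h)+\overline{S_q(g)}$ satisfies the defining condition of $\mathcal{W}_{\mathcal{H}_n^0}(\alpha)$ for $\|z\|_\infty<\frac{1}{2n^5}$; that is, for all $z\in\mathbb{C}^n$ with $\|z\|_\infty<\frac{1}{2n^5}$ and all $j,k,l\in\{1,\dots,n\}$, $$\Re\left(\frac{\partial S_1(h)(z)}{\partial z_k}+\alpha z_l\frac{\partial^2S_1(h)(z)}{\partial z_j\partial z_k}\right)>\left|\frac{\partial S_q(g)(z)}{\partial z_k}+\alpha z_l\frac{\partial^2S_q(g)(z)}{\partial z_j\partial z_k}\right|.$$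
   Context: $\|z\|_\infty=\max_{1\le i\le n}|z_i|$, and $\mathbb{P}\Delta(0;1)=\{z\in\mathbb{C}^n:\|z\|_\infty<1\}$ is the unit polydisk. For a multi-index $\beta=(\beta_1,\dots,\beta_n)$ of non-negative integers, $|\beta|=\beta_1+\cdots+\beta_n$ and $z^\beta=z_1^{\beta_1}\cdots z_n^{\beta_n}$. $\mathcal{H}_n^0$ is the class of complex-valued pluriharmonic functions $f$ in $\mathbb{P}\Delta(0;1)$ with $f(0)=0$, $\frac{\partial f}{\partial z_j}(0)=1$ and $\frac{\partial f}{\partial\overline{z}_j}(0)=0$ for $j=1,\dots,n$; every such $f$ is written $f=h+\overline{g}$ with $h,g$ holomorphic in $\mathbb{P}\Delta(0;1)$ and $h(0)=g(0)=0$. For $\alpha\ge0$, $\mathcal{W}_{\mathcal{H}_n^0}(\alpha)$ is the class of all $f=h+\overline{g}\in\mathcal{H}_n^0$ such that for all $z\in\mathbb{P}\Delta(0;1)$ and all $j,k,l\in\{1,\dots,n\}$, $$\Re\left(\frac{\partial h(z)}{\partial z_k}+\alpha z_l\frac{\partial^2h(z)}{\partial z_j\partial z_k}\right)>\left|\frac{\partial g(z)}{\partial z_k}+\alpha z_l\frac{\partial^2g(z)}{\partial z_j\partial z_k}\right|.$$ Sections (partial sums): for $h$ and $g$ with the expansions $h(z)=\sum_{j=1}^n z_j+\sum_{m=2}^\infty\sum_{|\beta|=m}a_\beta z^\beta$ and $g(z)=\sum_{m=2}^\infty\sum_{|\beta|=m}b_\beta z^\beta$, $S_1(h)(z)=\sum_{k=1}^n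 z_k$ and, for $q\ge2$, $S_q(g)(z)=\sum_{m=2}^q\sum_{|\beta|=m}b_\beta z^\beta$. The $(1,q)$-th section of $f=h+\overline g$ is $S_{1,q}(f)=S_1(h)+\overline{S_q(g)}$. *)

theory Defs
  imports "HOL-Analysis.Analysis"
begin

text \<open>
  Points of $n$-dimensional complex space are vectors of type \<open>complex ^ 'n\<close>, with
  \<open>n = CARD('n)\<close>. The library's \<open>infnorm\<close> is not the maximum norm here: on
  \<open>complex ^ 'n\<close> it takes the maximum over real and imaginary parts separately.
\<close>

definition maxnorm :: "complex ^ 'n \<Rightarrow> real" where
  "maxnorm z = Max (range (\<lambda>i. cmod (z $ i)))"

definition unit_polydisk :: "(complex ^ 'n) set" where
  "unit_polydisk = {z. maxnorm z < 1}"

text \<open>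
  The Wirtinger derivatives $\frac12(\partial_{x_j} - i\,\partial_{y_j})$ and
  $\frac12(\partial_{x_j} + i\,\partial_{y_j})$, where $z_j = x_j + i y_j$. On holomorphic
  functions the first one is the complex partial derivative.
\<close>

definition dx :: "'n \<Rightarrow> (complex ^ 'n \<Rightarrow> complex) \<Rightarrow> complex ^ 'n \<Rightarrow> complex" where
  "dx j f z = vector_derivative (\<lambda>t::real. f (z + axis j (of_real t))) (at 0)"

definition dy :: "'n \<Rightarrow> (complex ^ 'n \<Rightarrow> complex) \<Rightarrow> complex ^ 'n \<Rightarrow> complex" where
  "dy j f z = vector_derivative (\<lambda>t::real. f (z + axis j (\<i> * of_real t))) (at 0)"

definition dz :: "'n \<Rightarrow> (complex ^ 'n \<Rightarrow> complex) \<Rightarrow> complex ^ 'n \<Rightarrow> complex" where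
  "dz j f z = (dx j f z - \<i> * dy j f z) / 2"

definition dzbar :: "'n \<Rightarrow> (complex ^ 'n \<Rightarrow> complex) \<Rightarrow> complex ^ 'n \<Rightarrow> complex" where
  "dzbar j f z = (dx j f z + \<i> * dy j f z) / 2"

text \<open>Here and below \<open>U\<close> is meant to be open. The derivative is required to be complex linear.\<close>

definition mv_holomorphic_on :: "(complex ^ 'n \<Rightarrow> complex) \<Rightarrow> (complex ^ 'n) set \<Rightarrow> bool" where
  "mv_holomorphic_on f U \<longleftrightarrow>
     (\<forall>z\<in>U. \<exists>c::complex ^ 'n. (f has_derivative (\<lambda>v. \<Sum>i\<in>UNIV. c $ i * v $ i)) (at z))"

definition C2_on :: "(complex ^ 'n \<Rightarrow> complex) \<Rightarrow> (complex ^ 'n) set \<Rightarrow> bool" where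
  "C2_on f U \<longleftrightarrow>
     (\<exists>(f' :: complex ^ 'n \<Rightarrow> ((complex ^ 'n) \<Rightarrow>\<^sub>L complex))
       (f'' :: complex ^ 'n \<Rightarrow> ((complex ^ 'n) \<Rightarrow>\<^sub>L ((complex ^ 'n) \<Rightarrow>\<^sub>L complex))).
        (\<forall>z\<in>U. (f has_derivative blinfun_apply (f' z)) (at z)) \<and>
        (\<forall>z\<in>U. (f' has_derivative blinfun_apply (f'' z)) (at z)) \<and>
        continuous_on U f'')"

definition pluriharmonic_on :: "(complex ^ 'n \<Rightarrow> complex) \<Rightarrow> (complex ^ 'n) set \<Rightarrow> bool" where
  "pluriharmonic_on f U \<longleftrightarrow> C2_on f U \<and> (\<forall>z\<in>U. \<forall>j k. dz j (dzbar k f) z = 0)"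

definition class_H0 :: "(complex ^ 'n \<Rightarrow> complex) set" where
  "class_H0 = {f. pluriharmonic_on f unit_polydisk \<and> f 0 = 0 \<and>
                  (\<forall>j. dz j f 0 = 1 \<and> dzbar j f 0 = 0)}"

definition canonical_decomp ::
  "(complex ^ 'n \<Rightarrow> complex) \<Rightarrow> (complex ^ 'n \<Rightarrow> complex) \<Rightarrow> (complex ^ 'n \<Rightarrow> complex) \<Rightarrow> bool" where
  "canonical_decomp f h g \<longleftrightarrow>
     mv_holomorphic_on h unit_polydisk \<and> mv_holomorphic_on g unit_polydisk \<and>
     h 0 = 0 \<and> g 0 = 0 \<and> (\<forall>z\<in>unit_polydisk. f z = h z + cnj (g z))"

definition W_condition ::
  "real \<Rightarrow> (complex ^ 'n \<Rightarrow> complex) \<Rightarrow> (complex ^ 'n \<Rightarrow> complex) \<Rightarrow> complex ^ 'n \<Rightarrow> bool" where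
  "W_condition \<alpha> h g z \<longleftrightarrow>
     (\<forall>j k l. Re (dz k h z + of_real \<alpha> * z $ l * dz j (dz k h) z)
              > cmod (dz k g z + of_real \<alpha> * z $ l * dz j (dz k g) z))"

text \<open>
  A class of functions \<open>f\<close>; since \<open>h\<close> and \<open>g\<close> vanish at the origin they are determined by
  \<open>f\<close> on the polydisk, so it does not matter that they are existentially quantified.
\<close>

definition class_W :: "real \<Rightarrow> (complex ^ 'n \<Rightarrow> complex) set" where
  "class_W \<alpha> = {f \<in> class_H0. \<exists>h g. canonical_decomp f h g \<and>
                    (\<forall>z\<in>unit_polydisk. W_condition \<alpha> h g z)}"

text \<open>Multi-indices are functions \<open>'n \<Rightarrow> nat\<close>.\<close>

definition homogeneous_part ::
  "(('n \<Rightarrow> nat) \<Rightarrow> complex) \<Rightarrow> nat \<Rightarrow> complex ^ 'n \<Rightarrow> complex" where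
  "homogeneous_part c m z =
     (\<Sum>\<beta> | (\<Sum>i\<in>UNIV. \<beta> i) = m. c \<beta> * (\<Prod>i\<in>UNIV. (z $ i) ^ \<beta> i))"

text \<open>
  The section of order 1 of \<open>h\<close> depends only on the normalised linear part of \<open>h\<close>, and the
  section of order \<open>q\<close> of \<open>g\<close> only on the coefficients \<open>b\<close> of \<open>g\<close>.
\<close>

definition section1 :: "complex ^ 'n \<Rightarrow> complex" where
  "section1 z = (\<Sum>k\<in>UNIV. z $ k)"

definition section_from2 ::
  "(('n \<Rightarrow> nat) \<Rightarrow> complex) \<Rightarrow> nat \<Rightarrow> complex ^ 'n \<Rightarrow> complex" where
  "section_from2 b q z = (\<Sum>m = 2..q. homogeneous_part b m z)"

end

theory Submission
  imports Defs "HOL-Complex_Analysis.Complex_Analysis"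
begin

text \<open>
  Fix \<open>j\<close>, \<open>k\<close>, \<open>l\<close> and write $L u = \partial_k u + \alpha z_l \partial_j \partial_k u$ for the
  expression in the defining condition, which says $|L g| < \Re (L h)$. The
  operator $L$ maps the homogeneous part of degree $m + 2$ of a function to a homogeneous
  polynomial of degree $m + 1$. For the section, $L S_1(h) = 1$, and $L S_q(g)$ is the sum of
  the first $q - 1$ homogeneous parts of $L g$, so that the claim is
  $|\sum_{1 \le m < q} P_m(z)| < 1$, where $P_m$ is the part of degree $m$ of $L g$.

  The condition bounds each $P_m$ by $1$ on the unit polydisk. Restrict to a complex line
  through the origin: $\varphi(\zeta) = L g(\zeta z) = \sum_m P_m(z) \zeta^m$ and
  $\psi(\zeta) = L h(\zeta z)$ satisfy $|\varphi| \le \Re \psi$ on the unit circle, and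
  $\psi(0) = 1$. The mean value of $\varphi(\zeta) \zeta^{-m}$ over the circle is $P_m(z)$ and
  that of $\Re \psi$ is $1$, hence $|P_m(z)| \le 1$ (\<open>norm_coeff_le_Re_constant_term\<close>,
  \<open>norm_W_part_le_1\<close>). If $\|z\|_\infty < 1/2$ this bound applies to $2 z$, homogeneity turns
  it into $|P_m(z)| \le 2^{-m}$, and a finite sum of these powers is less than $1$. The radius
  $1/(2 n^5)$ is at most $1/2$.

  The remaining work justifies the term by term differentiation of the expansions of \<open>h\<close> and
  \<open>g\<close> into homogeneous polynomials, which are only assumed to converge pointwise. Cauchy's
  estimate on complex lines through the origin makes the convergence geometric on smaller
  polydisks, and a second use of it, on lines parallel to an axis, shows that the derivative
  is of the same kind (\<open>homogeneous_expansion_dz\<close>), so the step can be repeated. Finally,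
  membership in the class speaks of some decomposition of \<open>f\<close>; it is the given one by
  \<open>canonical_decomp_unique\<close>.
\<close>

(* The dollar sign denotes vector components throughout, not coefficients of power series. *)
unbundle no fps_syntax

section \<open>Power series dominated by a real part on the unit circle\<close>

text \<open>
  Coefficients are Fourier coefficients of the boundary values. This is Cauchy's formula for
  the derivatives at \<open>0\<close>, parametrised by the angle.
\<close>

lemma has_integral_power_series_coeff:
  fixes p :: "nat \<Rightarrow> complex"
  assumes "R > 1" and p: "\<And>\<zeta>. cmod \<zeta> < R \<Longrightarrow> (\<lambda>m. p m * \<zeta> ^ m) sums \<phi> \<zeta>"
  shows "((\<lambda>t. \<phi> (cis t) / cis t ^ m) has_integral (2 * of_real pi * p m)) {0..2 * pi}"
proof -
  have hol: "\<phi> holomorphic_on ball 0 R"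
    by (rule power_series_holomorphic[of 0 R p]) (use p in auto)
  have "\<phi> has_fps_expansion Abs_fps p"
  proof (rule has_fps_expansionI)
    have "eventually (\<lambda>u. u \<in> ball (0::complex) R) (nhds 0)"
      using \<open>R > 1\<close> by (intro eventually_nhds_in_open) auto
    thus "\<forall>\<^sub>F u in nhds 0. (\<lambda>n. fps_nth (Abs_fps p) n * u ^ n) sums \<phi> u"
      by eventually_elim (use p in auto)
  qed
  moreover have "\<phi> has_fps_expansion fps_expansion \<phi> 0"
    using hol \<open>R > 1\<close> by (intro has_fps_expansion_fps_expansion[of "ball 0 R"]) auto
  ultimately have "Abs_fps p = fps_expansion \<phi> 0"
    by (rule fps_expansion_unique_complex)
  from arg_cong[OF this, of "\<lambda>F. fps_nth F m"] have pm: "p m = (deriv ^^ m) \<phi> 0 / fact m"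
    by (simp add: fps_expansion_def)
  have "((\<lambda>u. \<phi> u / (u - 0) ^ Suc m) has_contour_integral
          (2 * pi * \<i>) / fact m * (deriv ^^ m) \<phi> 0) (circlepath 0 1)"
    using \<open>R > 1\<close>
    by (intro Cauchy_has_contour_integral_higher_derivative_circlepath
          holomorphic_on_subset[OF hol] holomorphic_on_imp_continuous_on) auto
  hence "((\<lambda>t. \<phi> (cis t) / cis t ^ Suc m * \<i> * cis t) has_integral
          (2 * pi * \<i>) / fact m * (deriv ^^ m) \<phi> 0) {0..2 * pi}"
    by (simp add: circlepath_def has_contour_integral_part_circlepath_iff)
  from has_integral_mult_right[OF this, of "-\<i>"] show ?thesis
    by (simp add: pm field_simps)
qed

text \<open>
  Harmonicity of \<open>Re \<psi>\<close> is what makes this work: integrating the pointwise bound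
  over the circle leaves only the constant term on the right.
\<close>

lemma norm_coeff_le_Re_constant_term:
  fixes p q :: "nat \<Rightarrow> complex"
  assumes R: "R > 1"
    and p: "\<And>\<zeta>. cmod \<zeta> < R \<Longrightarrow> (\<lambda>m. p m * \<zeta> ^ m) sums \<phi> \<zeta>"
    and q: "\<And>\<zeta>. cmod \<zeta> < R \<Longrightarrow> (\<lambda>m. q m * \<zeta> ^ m) sums \<psi> \<zeta>"
    and le: "\<And>\<zeta>. cmod \<zeta> = 1 \<Longrightarrow> cmod (\<phi> \<zeta>) \<le> Re (\<psi> \<zeta>)"
  shows "cmod (p m) \<le> Re (q 0)"
proof -
  note Ip = has_integral_power_series_coeff[OF R p, where m=m]
  have Iq: "((\<lambda>t. Re (\<psi> (cis t))) has_integral (2 * pi * Re (q 0))) {0..2 * pi}"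
    using has_integral_Re[OF has_integral_power_series_coeff[OF R q, where m=0]] by simp
  have "cmod (integral {0..2 * pi} (\<lambda>t. \<phi> (cis t) / cis t ^ m))
          \<le> integral {0..2 * pi} (\<lambda>t. Re (\<psi> (cis t)))"
    using Ip Iq le
    by (intro Henstock_Kurzweil_Integration.integral_norm_bound_integral)
       (auto simp: has_integral_integrable norm_divide norm_power)
  hence "2 * pi * cmod (p m) \<le> 2 * pi * Re (q 0)"
    using integral_unique[OF Ip] integral_unique[OF Iq] by (simp add: norm_mult)
  thus ?thesis by simp
qed

corollary norm_coeff_le_bound:
  fixes p :: "nat \<Rightarrow> complex"
  assumes "R > 1"
    and "\<And>\<zeta>. cmod \<zeta> < R \<Longrightarrow> (\<lambda>m. p m * \<zeta> ^ m) sums \<phi> \<zeta>"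
    and "\<And>\<zeta>. cmod \<zeta> = 1 \<Longrightarrow> cmod (\<phi> \<zeta>) \<le> B"
  shows "cmod (p m) \<le> B"
proof -
  define q :: "nat \<Rightarrow> complex" where "q = (\<lambda>m. of_real B * (if m = 0 then 1 else 0))"
  have "(\<lambda>m. q m * \<zeta> ^ m) sums of_real B" for \<zeta>
    using sums_mult[OF powser_sums_if[of 0 \<zeta>], of "of_real B"]
    by (simp only: q_def mult.assoc power_0 mult_1_right)
  with assms have "cmod (p m) \<le> Re (q 0)"
    by (intro norm_coeff_le_Re_constant_term[where \<psi> = "\<lambda>_. of_real B"]) auto
  thus ?thesis by (simp add: q_def)
qed

section \<open>Polydisks\<close>

lemma maxnorm_less_iff: "maxnorm z < r \<longleftrightarrow> (\<forall>i. cmod (z $ i) < r)"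
  by (simp add: maxnorm_def)

lemma maxnorm_le_iff: "maxnorm z \<le> r \<longleftrightarrow> (\<forall>i. cmod (z $ i) \<le> r)"
  by (simp add: maxnorm_def)

lemma maxnorm_nonneg: "0 \<le> maxnorm z"
  using maxnorm_le_iff[of z "maxnorm z"] norm_ge_zero order_trans by blast

lemma maxnorm_scale: "maxnorm (c *s z) = cmod c * maxnorm z"
proof -
  have "Max ((\<lambda>x. cmod c * x) ` range (\<lambda>i. cmod (z $ i))) = cmod c * Max (range (\<lambda>i. cmod (z $ i)))"
    by (rule mono_Max_commute[symmetric]) (auto intro!: monoI mult_left_mono)
  thus ?thesis by (simp add: maxnorm_def norm_mult image_image)
qed

lemma maxnorm_add_axis_le: "maxnorm (z + axis k s) \<le> maxnorm z + cmod s"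
proof -
  have "cmod ((z + axis k s) $ i) \<le> maxnorm z + cmod s" for i
  proof -
    have "cmod (z $ i) \<le> maxnorm z" using maxnorm_le_iff by blast
    moreover have "cmod (axis k s $ i) \<le> cmod s" by (simp add: axis_def)
    ultimately show ?thesis
      using norm_triangle_ineq[of "z $ i" "axis k s $ i"] by simp
  qed
  thus ?thesis by (simp add: maxnorm_le_iff)
qed

lemma open_unit_polydisk: "open (unit_polydisk :: (complex ^ 'n) set)"
proof -
  have eq: "unit_polydisk = (\<Inter>i. {z :: complex ^ 'n. cmod (z $ i) < 1})"
    by (auto simp: unit_polydisk_def maxnorm_less_iff)
  show ?thesis unfolding eq
    by (intro open_INT ballI open_Collect_less continuous_intros) auto
qed

lemma convex_unit_polydisk: "convex (unit_polydisk :: (complex ^ 'n) set)"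
proof -
  have eq: "unit_polydisk = (\<Inter>i. (\<lambda>z :: complex ^ 'n. z $ i) -` ball 0 1)"
    by (auto simp: unit_polydisk_def maxnorm_less_iff)
  show ?thesis unfolding eq
    by (intro convex_INT convex_linear_vimage bounded_linear.linear bounded_linear_vec_nth convex_ball)
qed

lemma compact_closed_polydisk: "compact {z :: complex ^ 'n. maxnorm z \<le> r}"
proof -
  have "norm z \<le> real CARD('n) * r" if "maxnorm z \<le> r" for z :: "complex ^ 'n"
  proof -
    have "norm z \<le> (\<Sum>i\<in>UNIV. cmod (z $ i))"
      unfolding norm_vec_def by (rule L2_set_le_sum) simp
    also have "\<dots> \<le> real CARD('n) * r"
      using that sum_bounded_above[of UNIV "\<lambda>i. cmod (z $ i)" r] by (simp add: maxnorm_le_iff)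
    finally show ?thesis .
  qed
  hence "bounded {z :: complex ^ 'n. maxnorm z \<le> r}"
    by (auto simp: bounded_iff)
  moreover have "closed {z :: complex ^ 'n. maxnorm z \<le> r}"
    unfolding maxnorm_le_iff
    by (intro closed_Collect_all closed_Collect_le continuous_intros)
  ultimately show ?thesis by (simp add: compact_eq_bounded_closed)
qed

section \<open>Homogeneous polynomials\<close>

definition partial_deriv_coeffs :: "'n \<Rightarrow> (('n \<Rightarrow> nat) \<Rightarrow> complex) \<Rightarrow> ('n \<Rightarrow> nat) \<Rightarrow> complex" where
  "partial_deriv_coeffs k c \<beta> = of_nat (Suc (\<beta> k)) * c (\<beta>(k := Suc (\<beta> k)))"

lemma finite_multiindices: "finite {\<beta> :: 'n::finite \<Rightarrow> nat. (\<Sum>i\<in>UNIV. \<beta> i) = m}"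
proof (rule finite_subset)
  show "{\<beta> :: 'n \<Rightarrow> nat. (\<Sum>i\<in>UNIV. \<beta> i) = m} \<subseteq> UNIV \<rightarrow>\<^sub>E {..m}"
    by (auto intro: member_le_sum)
  show "finite (UNIV \<rightarrow>\<^sub>E {..m} :: ('n \<Rightarrow> nat) set)"
    by (intro finite_PiE) auto
qed

text \<open>
  Raising the \<open>k\<close>-th exponent is a bijection from the multi-indices of degree \<open>m\<close> onto those
  of degree \<open>Suc m\<close> that are positive at \<open>k\<close>; the hypothesis on \<open>F\<close> discards the others, whose
  monomials are killed by the derivative in direction \<open>k\<close>.
\<close>

lemma sum_multiindices_raise:
  fixes F :: "('n::finite \<Rightarrow> nat) \<Rightarrow> complex"
  assumes "\<And>\<beta>. \<beta> k = 0 \<Longrightarrow> F \<beta> = 0"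
  shows "(\<Sum>\<beta> | (\<Sum>i\<in>UNIV. \<beta> i) = Suc m. F \<beta>)
       = (\<Sum>\<gamma> | (\<Sum>i\<in>UNIV. \<gamma> i) = m. F (\<gamma>(k := Suc (\<gamma> k))))"
proof -
  have deg: "(\<Sum>i\<in>UNIV. (\<beta>(k := x)) i) + \<beta> k = (\<Sum>i\<in>UNIV. \<beta> i) + x" for \<beta> :: "'n \<Rightarrow> nat" and x
    using sum.remove[of UNIV k "\<beta>(k := x)"] sum.remove[of UNIV k \<beta>] by simp
  have "(\<Sum>\<gamma> | (\<Sum>i\<in>UNIV. \<gamma> i) = m. F (\<gamma>(k := Suc (\<gamma> k))))
      = (\<Sum>\<beta> | (\<Sum>i\<in>UNIV. \<beta> i) = Suc m \<and> \<beta> k \<noteq> 0. F \<beta>)"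
  proof (rule sum.reindex_bij_witness[where
        j = "\<lambda>\<gamma>. \<gamma>(k := Suc (\<gamma> k))" and i = "\<lambda>\<beta>. \<beta>(k := \<beta> k - 1)"], goal_cases)
    case (2 \<gamma>) thus ?case using deg[of \<gamma> "Suc (\<gamma> k)"] by simp
  next
    case (4 \<beta>) thus ?case using deg[of \<beta> "\<beta> k - 1"] by simp
  qed auto
  also have "\<dots> = (\<Sum>\<beta> | (\<Sum>i\<in>UNIV. \<beta> i) = Suc m. F \<beta>)"
    by (intro sum.mono_neutral_left finite_multiindices) (auto simp: assms)
  finally show ?thesis by simp
qed

lemma homogeneous_part_scale:
  "homogeneous_part c m (\<zeta> *s z) = \<zeta> ^ m * homogeneous_part c m z"
  unfolding homogeneous_part_def sum_distrib_left
  by (intro sum.cong)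
     (auto simp: power_mult_distrib prod.distrib simp flip: power_sum)

lemma prod_add_axis:
  fixes z :: "complex ^ 'n"
  shows "(\<Prod>i\<in>UNIV. ((z + axis k s) $ i) ^ \<beta> i) = (z $ k + s) ^ \<beta> k * (\<Prod>i\<in>UNIV - {k}. (z $ i) ^ \<beta> i)"
proof -
  have "(\<Prod>i\<in>UNIV. ((z + axis k s) $ i) ^ \<beta> i)
      = ((z + axis k s) $ k) ^ \<beta> k * (\<Prod>i\<in>UNIV - {k}. ((z + axis k s) $ i) ^ \<beta> i)"
    by (rule prod.remove) auto
  also have "(\<Prod>i\<in>UNIV - {k}. ((z + axis k s) $ i) ^ \<beta> i) = (\<Prod>i\<in>UNIV - {k}. (z $ i) ^ \<beta> i)"
    by (intro prod.cong) (auto simp: axis_def)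
  finally show ?thesis by (simp add: axis_def)
qed

lemma homogeneous_part_has_derivative_axis:
  "((\<lambda>s. homogeneous_part c (Suc m) (z + axis k s)) has_field_derivative
     homogeneous_part (partial_deriv_coeffs k c) m (z + axis k s)) (at s)"
proof -
  let ?D = "\<lambda>\<beta>. c \<beta> * (of_nat (\<beta> k) * (z $ k + s) ^ (\<beta> k - 1) * (\<Prod>i\<in>UNIV - {k}. (z $ i) ^ \<beta> i))"
  have "((\<lambda>s. homogeneous_part c (Suc m) (z + axis k s)) has_field_derivative
      (\<Sum>\<beta> | (\<Sum>i\<in>UNIV. \<beta> i) = Suc m. ?D \<beta>)) (at s)"
    unfolding homogeneous_part_def prod_add_axis
    by (auto intro!: derivative_eq_intros sum.cong)
  also have "(\<Sum>\<beta> | (\<Sum>i\<in>UNIV. \<beta> i) = Suc m. ?D \<beta>) = homogeneous_part (partial_deriv_coeffs k c) m (z + axis k s)"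
  proof -
    have "(\<Sum>\<beta> | (\<Sum>i\<in>UNIV. \<beta> i) = Suc m. ?D \<beta>)
        = (\<Sum>\<gamma> | (\<Sum>i\<in>UNIV. \<gamma> i) = m. ?D (\<gamma>(k := Suc (\<gamma> k))))"
      by (rule sum_multiindices_raise) simp
    also have "\<dots> = homogeneous_part (partial_deriv_coeffs k c) m (z + axis k s)"
      unfolding homogeneous_part_def prod_add_axis
    proof (rule sum.cong[OF refl], goal_cases)
      case (1 \<gamma>)
      have "(\<Prod>i\<in>UNIV - {k}. (z $ i) ^ (\<gamma>(k := Suc (\<gamma> k))) i) = (\<Prod>i\<in>UNIV - {k}. (z $ i) ^ \<gamma> i)"
        by (intro prod.cong) auto
      thus ?case by (simp add: partial_deriv_coeffs_def mult_ac)
    qed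
    finally show ?thesis .
  qed
  finally show ?thesis .
qed

section \<open>The Wirtinger derivative along a complex line\<close>

text \<open>
  For a function that is complex differentiable with derivative \<open>D\<close> on the line, the real
  derivatives are \<open>D\<close> and \<open>\<i> * D\<close>, and the combination in \<open>dz\<close> gives \<open>D\<close> back.
\<close>

lemma dz_eqI:
  assumes "((\<lambda>s. u (z + axis k s)) has_field_derivative D) (at 0)"
  shows "dz k u z = D"
proof -
  have d: "((\<lambda>t::real. u (z + axis k (a * of_real t))) has_vector_derivative a * D) (at 0)" for a
  proof -
    have "((\<lambda>t. a * complex_of_real t) has_vector_derivative a) (at 0)"
      by (auto intro!: derivative_eq_intros)
    from field_vector_diff_chain_at[OF this, of "\<lambda>s. u (z + axis k s)" D] assms
    show ?thesis by (simp add: o_def)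
  qed
  show ?thesis
    using vector_derivative_at[OF d[of 1]] vector_derivative_at[OF d[of \<i>]]
    by (simp add: dz_def dx_def dy_def)
qed

lemma axis_zero [simp]: "axis k (0 :: complex) = 0"
  by (simp add: axis_eq_0_iff)

lemma continuous_on_add_axis: "continuous_on A (\<lambda>s::complex. z + axis k s)"
proof -
  have "continuous_on A (\<lambda>s::complex. if i = k then s else 0)" for i
    by (cases "i = k") simp_all
  thus ?thesis
    unfolding axis_def by (intro continuous_on_add continuous_on_const continuous_on_vec_lambda)
qed

lemma eventually_add_axis_in:
  assumes "open U" "z \<in> U"
  shows "\<forall>\<^sub>F s in nhds (0::complex). z + axis k s \<in> U"
proof -
  have "open ((\<lambda>s. z + axis k s) -` U)"
    using assms continuous_on_add_axis by (intro open_vimage) auto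
  moreover have "0 \<in> (\<lambda>s. z + axis k s) -` U"
    using assms by simp
  ultimately show ?thesis
    unfolding eventually_nhds by (intro exI[of _ "(\<lambda>s. z + axis k s) -` U"]) auto
qed

lemma dz_cong:
  assumes "open U" "z \<in> U" "\<And>w. w \<in> U \<Longrightarrow> u w = v w"
  shows "dz k u z = dz k v z"
proof -
  have "vector_derivative (\<lambda>t. u (z + axis k (a * complex_of_real t))) (at 0)
      = vector_derivative (\<lambda>t. v (z + axis k (a * complex_of_real t))) (at 0)" for a
  proof (rule vector_derivative_cong_eq)
    have "((\<lambda>t. a * complex_of_real t) \<longlongrightarrow> 0) (nhds 0)"
      by (rule tendsto_eq_intros refl filterlim_ident | simp)+
    from eventually_compose_filterlim[OF eventually_add_axis_in[OF assms(1,2), of k] this]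
    show "\<forall>\<^sub>F t in nhds 0. t \<in> UNIV \<longrightarrow>
        u (z + axis k (a * complex_of_real t)) = v (z + axis k (a * complex_of_real t))"
      by eventually_elim (simp add: assms(3))
  qed auto
  from this[of 1] this[of \<i>] show ?thesis
    by (simp add: dz_def dx_def dy_def)
qed

lemma dz_dz_cong:
  assumes "open U" "z \<in> U" "\<And>w. w \<in> U \<Longrightarrow> u w = v w"
  shows "dz j (dz k u) z = dz j (dz k v) z"
  by (rule dz_cong[OF assms(1,2)]) (rule dz_cong[OF assms(1) _ assms(3)])

section \<open>Expansions into homogeneous polynomials\<close>

text \<open>
  The lowest degree \<open>d\<close> drops by one with each differentiation, and the index shift keeps
  the sum starting at \<open>0\<close>. Boundedness on smaller polydisks is carried along, in place of
  holomorphy, because it is preserved by partial derivatives through Cauchy's estimate alone.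
\<close>

definition homogeneous_expansion ::
  "nat \<Rightarrow> (('n \<Rightarrow> nat) \<Rightarrow> complex) \<Rightarrow> (complex ^ 'n \<Rightarrow> complex) \<Rightarrow> bool" where
  "homogeneous_expansion d c u \<longleftrightarrow>
     (\<forall>z\<in>unit_polydisk. (\<lambda>m. homogeneous_part c (m + d) z) sums u z) \<and>
     (\<forall>r<1. \<exists>B. \<forall>z. maxnorm z \<le> r \<longrightarrow> cmod (u z) \<le> B)"

text \<open>
  On a line through the origin the expansion is a power series in one variable; the terms
  below \<open>d\<close> are filled up by zeros so that coefficient \<open>m\<close> belongs to the power \<open>m\<close>.
\<close>

lemma homogeneous_expansion_on_ray:
  assumes "homogeneous_expansion d c u" "cmod \<zeta> * maxnorm z < 1"
  shows "(\<lambda>m. (if m < d then 0 else homogeneous_part c m z) * \<zeta> ^ m) sums u (\<zeta> *s z)"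
proof -
  have "\<zeta> *s z \<in> unit_polydisk"
    using assms(2) by (simp add: unit_polydisk_def maxnorm_scale)
  hence "(\<lambda>m. homogeneous_part c (m + d) (\<zeta> *s z)) sums u (\<zeta> *s z)"
    using assms(1) by (simp add: homogeneous_expansion_def)
  also have "(\<lambda>m. homogeneous_part c (m + d) (\<zeta> *s z))
    = (\<lambda>m. (if m + d < d then 0 else homogeneous_part c (m + d) z) * \<zeta> ^ (m + d))"
    by (simp add: homogeneous_part_scale mult.commute)
  finally show ?thesis
    by (subst (asm) sums_zero_iff_shift) auto
qed

text \<open>
  Room for the closed unit disk in the parameter \<open>\<zeta>\<close>, as needed for integrating over the unit
  circle.
\<close>

lemma polydisk_ray_beyond_unit_circle:
  assumes "maxnorm z < 1"
  obtains R where "R > 1" "\<And>\<zeta>. cmod \<zeta> < R \<Longrightarrow> cmod \<zeta> * maxnorm z < 1"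
proof
  let ?R = "2 / (1 + maxnorm z)"
  show "?R > 1"
    using assms maxnorm_nonneg[of z] by (simp add: field_simps)
  fix \<zeta> :: complex assume "cmod \<zeta> < ?R"
  hence "cmod \<zeta> * maxnorm z \<le> ?R * maxnorm z"
    by (intro mult_right_mono maxnorm_nonneg) auto
  also have "\<dots> < 1"
    using assms maxnorm_nonneg[of z] by (simp add: field_simps)
  finally show "cmod \<zeta> * maxnorm z < 1" .
qed

lemma homogeneous_expansion_bounded:
  assumes "homogeneous_expansion d c u" "r < 1"
  obtains B where "\<And>z. maxnorm z \<le> r \<Longrightarrow> cmod (u z) \<le> B"
  using assms unfolding homogeneous_expansion_def by meson

lemma homogeneous_expansion_part_bounded:
  fixes c :: "('n::finite \<Rightarrow> nat) \<Rightarrow> complex"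
  assumes u: "homogeneous_expansion d c u" and "r < 1"
  obtains B where "\<And>m (z :: complex ^ 'n). d \<le> m \<Longrightarrow> maxnorm z \<le> r \<Longrightarrow> cmod (homogeneous_part c m z) \<le> B"
proof -
  obtain B where B: "\<And>z. maxnorm z \<le> r \<Longrightarrow> cmod (u z) \<le> B"
    using homogeneous_expansion_bounded[OF assms] by metis
  show ?thesis
  proof (rule that[of B])
    fix m and z :: "complex ^ 'n" assume "d \<le> m" and z: "maxnorm z \<le> r"
    have "maxnorm z < 1" using z \<open>r < 1\<close> by simp
    then obtain R where R: "R > 1" and ray: "\<And>\<zeta>. cmod \<zeta> < R \<Longrightarrow> cmod \<zeta> * maxnorm z < 1"
      using polydisk_ray_beyond_unit_circle by metis
    have "cmod (if m < d then 0 else homogeneous_part c m z) \<le> B"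
    proof (rule norm_coeff_le_bound[OF R, where \<phi> = "\<lambda>\<zeta>. u (\<zeta> *s z)" and
          p = "\<lambda>m. if m < d then 0 else homogeneous_part c m z"])
      show "(\<lambda>m. (if m < d then 0 else homogeneous_part c m z) * \<zeta> ^ m) sums u (\<zeta> *s z)"
        if "cmod \<zeta> < R" for \<zeta>
        by (rule homogeneous_expansion_on_ray[OF u ray[OF that]])
      show "cmod (u (\<zeta> *s z)) \<le> B" if "cmod \<zeta> = 1" for \<zeta>
        using that z by (simp add: B maxnorm_scale)
    qed
    with \<open>d \<le> m\<close> show "cmod (homogeneous_part c m z) \<le> B" by simp
  qed
qed

text \<open>
  The uniform bound on a slightly larger polydisk becomes geometric decay after shrinking,
  since a part of degree \<open>m\<close> scales with \<open>t ^ m\<close>.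
\<close>

lemma homogeneous_expansion_part_geometric:
  fixes c :: "('n::finite \<Rightarrow> nat) \<Rightarrow> complex"
  assumes u: "homogeneous_expansion d c u" and "r < 1"
  obtains B t where "0 < t" "t < 1"
    "\<And>m (z :: complex ^ 'n). d \<le> m \<Longrightarrow> maxnorm z \<le> r \<Longrightarrow> cmod (homogeneous_part c m z) \<le> B * t ^ m"
proof -
  \<comment> \<open>Enlarging \<open>r\<close> to a positive radius keeps the scaling factor \<open>t\<close> invertible.\<close>
  define r0 where "r0 = max r (1/2)"
  define s where "s = (1 + r0) / 2"
  define t where "t = r0 / s"
  have rs: "r \<le> r0" "0 < r0" "r0 < s" "s < 1"
    using \<open>r < 1\<close> by (auto simp: r0_def s_def)
  have t: "0 < t" "t < 1" "r0 = t * s"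
    using rs by (auto simp: t_def)
  obtain B where B: "\<And>m z. d \<le> m \<Longrightarrow> maxnorm z \<le> s \<Longrightarrow> cmod (homogeneous_part c m z) \<le> B"
    using homogeneous_expansion_part_bounded[OF u \<open>s < 1\<close>] by metis
  show ?thesis
  proof (rule that[OF t(1,2)])
    fix m and z :: "complex ^ 'n" assume m: "d \<le> m" and z: "maxnorm z \<le> r"
    define w where "w = of_real (1 / t) *s z"
    have zw: "z = of_real t *s w"
      using t by (simp add: w_def vector_smult_assoc)
    have "maxnorm w = maxnorm z / t"
      using t by (simp add: w_def maxnorm_scale norm_divide)
    also have "\<dots> \<le> s"
      using t z rs by (simp add: field_simps)
    finally have "cmod (homogeneous_part c m w) \<le> B"
      using B m by simp
    thus "cmod (homogeneous_part c m z) \<le> B * t ^ m"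
      using t by (simp add: zw homogeneous_part_scale norm_mult norm_power mult.commute)
  qed
qed

text \<open>
  On the disk of radius \<open>(1 - r) / 2\<close> in the direction of an axis, the parts are dominated by a
  convergent geometric series, so the Weierstrass theorem for series of holomorphic functions
  gives differentiability and the series of the derivative. The last claim is Cauchy's estimate
  on the disk of half that radius.
\<close>

lemma homogeneous_expansion_deriv_at:
  assumes u: "homogeneous_expansion (Suc d) c u" and "r < 1"
    and B: "\<And>z. maxnorm z \<le> (1 + r) / 2 \<Longrightarrow> cmod (u z) \<le> B" and z: "maxnorm z \<le> r"
  shows "((\<lambda>s. u (z + axis k s)) has_field_derivative dz k u z) (at 0)"
    and "(\<lambda>m. homogeneous_part (partial_deriv_coeffs k c) (m + d) z) sums dz k u z"
    and "cmod (dz k u z) \<le> B * 4 / (1 - r)"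
proof -
  define e where "e = (1 - r) / 2"
  have e: "e > 0" "r + e = (1 + r) / 2" "r + e < 1"
    using \<open>r < 1\<close> by (auto simp: e_def field_simps)
  have near: "maxnorm (z + axis k s) \<le> r + e" if "s \<in> ball 0 e" for s
    using maxnorm_add_axis_le[of z k s] z that by simp
  obtain C t where t: "0 < t" "t < 1" and C:
    "\<And>m w. Suc d \<le> m \<Longrightarrow> maxnorm w \<le> r + e \<Longrightarrow> cmod (homogeneous_part c m w) \<le> C * t ^ m"
    using homogeneous_expansion_part_geometric[OF u \<open>r + e < 1\<close>] by metis
  obtain g g' where g: "\<forall>s\<in>ball 0 e.
      (\<lambda>m. homogeneous_part c (m + Suc d) (z + axis k s)) sums g s \<and>
      (\<lambda>m. homogeneous_part (partial_deriv_coeffs k c) (m + d) (z + axis k s)) sums g' s \<and>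
      (g has_field_derivative g' s) (at s)"
  proof (rule series_and_derivative_comparison)
    show "summable (\<lambda>m. C * t ^ (m + Suc d))"
      using t by (subst summable_iff_shift) (auto intro!: summable_mult summable_geometric)
    show "((\<lambda>s. homogeneous_part c (m + Suc d) (z + axis k s)) has_field_derivative
       homogeneous_part (partial_deriv_coeffs k c) (m + d) (z + axis k s)) (at s)" for m s
      using homogeneous_part_has_derivative_axis[of c "m + d"] by simp
    show "\<forall>\<^sub>F m in sequentially. \<forall>s\<in>ball 0 e.
       cmod (homogeneous_part c (m + Suc d) (z + axis k s)) \<le> C * t ^ (m + Suc d)"
      by (intro always_eventually allI ballI C near) simp_all
  qed auto
  have ug: "u (z + axis k s) = g s" if "s \<in> ball 0 e" for s
  proof -
    have "z + axis k s \<in> unit_polydisk"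
      using near[OF that] e by (simp add: unit_polydisk_def)
    hence "(\<lambda>m. homogeneous_part c (m + Suc d) (z + axis k s)) sums u (z + axis k s)"
      using u by (simp add: homogeneous_expansion_def)
    with g that show ?thesis using sums_unique2 by blast
  qed
  have der: "((\<lambda>s. u (z + axis k s)) has_field_derivative g' s) (at s)" if "s \<in> ball 0 e" for s
  proof -
    have "(g has_field_derivative g' s) (at s)"
      using g that by blast
    thus ?thesis
      by (rule has_field_derivative_transform_within_open[OF _ open_ball that]) (simp add: ug)
  qed
  have D: "dz k u z = g' 0"
    using der[of 0] e by (intro dz_eqI) auto
  show "((\<lambda>s. u (z + axis k s)) has_field_derivative dz k u z) (at 0)"
    using der[of 0] e by (simp add: D)
  show "(\<lambda>m. homogeneous_part (partial_deriv_coeffs k c) (m + d) z) sums dz k u z"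
    using bspec[OF g, of 0] e by (simp add: D)
  have hol: "(\<lambda>s. u (z + axis k s)) holomorphic_on ball 0 e"
    unfolding holomorphic_on_open[OF open_ball] using der by blast
  have "cmod ((deriv ^^ 1) (\<lambda>s. u (z + axis k s)) 0) \<le> fact 1 * B / (e / 2) ^ 1"
  proof (rule Cauchy_inequality)
    show "(\<lambda>s. u (z + axis k s)) holomorphic_on ball 0 (e / 2)"
      using e by (intro holomorphic_on_subset[OF hol]) auto
    show "continuous_on (cball 0 (e / 2)) (\<lambda>s. u (z + axis k s))"
      using e by (intro holomorphic_on_imp_continuous_on holomorphic_on_subset[OF hol]) auto
    show "cmod (u (z + axis k s)) \<le> B" if "cmod (0 - s) = e / 2" for s
      using near[of s] e that by (intro B) auto
  qed (use e in auto)
  thus "cmod (dz k u z) \<le> B * 4 / (1 - r)"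
    using DERIV_imp_deriv[OF der[of 0]] e by (simp add: D e_def)
qed

lemma homogeneous_expansion_has_derivative:
  assumes u: "homogeneous_expansion (Suc d) c u" and "z \<in> unit_polydisk"
  shows "((\<lambda>s. u (z + axis k s)) has_field_derivative dz k u z) (at 0)"
proof -
  have r: "maxnorm z < 1" using assms(2) by (simp add: unit_polydisk_def)
  hence "(1 + maxnorm z) / 2 < 1" by simp
  then obtain B where "\<And>w. maxnorm w \<le> (1 + maxnorm z) / 2 \<Longrightarrow> cmod (u w) \<le> B"
    using homogeneous_expansion_bounded[OF u] by metis
  from homogeneous_expansion_deriv_at(1)[OF u r this order_refl] show ?thesis .
qed

lemma homogeneous_expansion_dz:
  fixes c :: "('n::finite \<Rightarrow> nat) \<Rightarrow> complex"
  assumes u: "homogeneous_expansion (Suc d) c u"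
  shows "homogeneous_expansion d (partial_deriv_coeffs k c) (dz k u)"
  unfolding homogeneous_expansion_def
proof (intro conjI ballI allI impI)
  fix z :: "complex ^ 'n" assume "z \<in> unit_polydisk"
  hence r: "maxnorm z < 1" by (simp add: unit_polydisk_def)
  hence "(1 + maxnorm z) / 2 < 1" by simp
  then obtain B where "\<And>w. maxnorm w \<le> (1 + maxnorm z) / 2 \<Longrightarrow> cmod (u w) \<le> B"
    using homogeneous_expansion_bounded[OF u] by metis
  from homogeneous_expansion_deriv_at(2)[OF u r this order_refl]
  show "(\<lambda>m. homogeneous_part (partial_deriv_coeffs k c) (m + d) z) sums dz k u z" .
next
  fix r :: real assume r: "r < 1"
  hence "(1 + r) / 2 < 1" by simp
  then obtain B where "\<And>w. maxnorm w \<le> (1 + r) / 2 \<Longrightarrow> cmod (u w) \<le> B"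
    using homogeneous_expansion_bounded[OF u] by metis
  from homogeneous_expansion_deriv_at(3)[OF u r this]
  show "\<exists>B. \<forall>z. maxnorm z \<le> r \<longrightarrow> cmod (dz k u z) \<le> B" by blast
qed

section \<open>Holomorphic functions on the polydisk\<close>

lemma mv_holomorphic_bounded:
  assumes "mv_holomorphic_on u unit_polydisk" "r < 1"
  shows "\<exists>B. \<forall>z. maxnorm z \<le> r \<longrightarrow> cmod (u z) \<le> B"
proof -
  have "isCont u z" if "maxnorm z \<le> r" for z
  proof -
    have "z \<in> unit_polydisk"
      using that \<open>r < 1\<close> by (simp add: unit_polydisk_def)
    then obtain c where "(u has_derivative (\<lambda>v. \<Sum>i\<in>UNIV. c $ i * v $ i)) (at z)"
      using assms(1) unfolding mv_holomorphic_on_def by blast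
    thus ?thesis by (rule has_derivative_continuous)
  qed
  hence "continuous_on {z. maxnorm z \<le> r} u"
    by (intro continuous_at_imp_continuous_on) auto
  hence "bounded (u ` {z. maxnorm z \<le> r})"
    by (intro compact_imp_bounded compact_continuous_image compact_closed_polydisk)
  thus ?thesis by (auto simp: bounded_iff)
qed

lemma mv_holomorphic_imp_homogeneous_expansion:
  assumes "mv_holomorphic_on u unit_polydisk"
    and "\<And>z. z \<in> unit_polydisk \<Longrightarrow> (\<lambda>m. homogeneous_part c (m + d) z) sums u z"
  shows "homogeneous_expansion d c u"
  unfolding homogeneous_expansion_def using assms mv_holomorphic_bounded by blast

text \<open>
  The derivative of \<open>F\<close> is both complex linear and conjugate linear, hence zero.
\<close>

lemma mv_holomorphic_eq_cnj_imp_constant: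
  fixes F G :: "complex ^ 'n \<Rightarrow> complex"
  assumes F: "mv_holomorphic_on F U" and G: "mv_holomorphic_on G U"
    and eq: "\<And>z. z \<in> U \<Longrightarrow> F z = cnj (G z)"
    and U: "open U" "convex U" and zw: "z \<in> U" "w \<in> U"
  shows "F z = F w"
proof -
  have der0: "(F has_derivative (\<lambda>v. 0)) (at x)" if x: "x \<in> U" for x
  proof -
    obtain c where c: "(F has_derivative (\<lambda>v. \<Sum>i\<in>UNIV. c $ i * v $ i)) (at x)"
      using F x unfolding mv_holomorphic_on_def by blast
    obtain d where "(G has_derivative (\<lambda>v. \<Sum>i\<in>UNIV. d $ i * v $ i)) (at x)"
      using G x unfolding mv_holomorphic_on_def by blast
    hence "((\<lambda>y. cnj (G y)) has_derivative (\<lambda>v. cnj (\<Sum>i\<in>UNIV. d $ i * v $ i))) (at x)"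
      by (rule has_derivative_cnj)
    hence "(F has_derivative (\<lambda>v. cnj (\<Sum>i\<in>UNIV. d $ i * v $ i))) (at x)"
      by (rule has_derivative_transform_within_open[OF _ U(1) x]) (simp add: eq)
    from has_derivative_unique[OF c this]
    have cd: "(\<Sum>i\<in>UNIV. c $ i * v $ i) = cnj (\<Sum>i\<in>UNIV. d $ i * v $ i)" for v
      by (rule fun_cong)
    have sum_axis: "(\<Sum>i\<in>UNIV. e $ i * axis k s $ i) = e $ k * s" for e :: "complex ^ 'n" and k s
      by (simp add: axis_def if_distrib cong: if_cong)
    have "c $ k = 0" for k
      using cd[of "axis k 1"] cd[of "axis k \<i>"] by (simp add: sum_axis)
    with c show ?thesis by simp
  qed
  show ?thesis
    by (rule has_derivative_zero_unique[OF U(2) _ zw]) (use der0 has_derivative_at_withinI in blast)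
qed

lemma mv_holomorphic_on_diff:
  assumes "mv_holomorphic_on u U" "mv_holomorphic_on v U"
  shows "mv_holomorphic_on (\<lambda>z. u z - v z) U"
  unfolding mv_holomorphic_on_def
proof
  fix z assume z: "z \<in> U"
  obtain c where c: "(u has_derivative (\<lambda>v. \<Sum>i\<in>UNIV. c $ i * v $ i)) (at z)"
    using assms(1) z unfolding mv_holomorphic_on_def by blast
  obtain d where d: "(v has_derivative (\<lambda>v. \<Sum>i\<in>UNIV. d $ i * v $ i)) (at z)"
    using assms(2) z unfolding mv_holomorphic_on_def by blast
  show "\<exists>e. ((\<lambda>z. u z - v z) has_derivative (\<lambda>v. \<Sum>i\<in>UNIV. e $ i * v $ i)) (at z)"
    using has_derivative_diff[OF c d]
    by (intro exI[of _ "c - d"]) (simp add: left_diff_distrib sum_subtractf)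
qed

text \<open>
  The difference of the holomorphic parts is the conjugate of a holomorphic function, so it is
  constant, and it vanishes at the origin.
\<close>

lemma canonical_decomp_unique:
  assumes 1: "canonical_decomp f h g" and 2: "canonical_decomp f h' g'" and z: "z \<in> unit_polydisk"
  shows "h z = h' z" "g z = g' z"
proof -
  have 0: "0 \<in> unit_polydisk" by (simp add: unit_polydisk_def maxnorm_less_iff)
  have eq: "h w + cnj (g w) = h' w + cnj (g' w)" if "w \<in> unit_polydisk" for w
    using 1 2 that by (metis canonical_decomp_def)
  have "h z - h' z = h 0 - h' 0"
  proof (rule mv_holomorphic_eq_cnj_imp_constant[where G = "\<lambda>w. g' w - g w"])
    show "h w - h' w = cnj (g' w - g w)" if "w \<in> unit_polydisk" for w
      using eq[OF that] by (simp add: algebra_simps)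
  qed (use 1 2 z 0 in \<open>auto simp: canonical_decomp_def open_unit_polydisk convex_unit_polydisk
         intro: mv_holomorphic_on_diff\<close>)
  thus "h z = h' z" using 1 2 by (simp add: canonical_decomp_def)
  with eq[OF z] show "g z = g' z" by simp
qed

section \<open>The expression in the defining condition\<close>

definition W_op where
  "W_op \<alpha> j k l u z = dz k u z + of_real \<alpha> * z $ l * dz j (dz k u) z"

lemma W_condition_iff:
  "W_condition \<alpha> h g z \<longleftrightarrow> (\<forall>j k l. cmod (W_op \<alpha> j k l g z) < Re (W_op \<alpha> j k l h z))"
  by (simp only: W_condition_def W_op_def)

text \<open>
  The homogeneous part of degree \<open>m + 1\<close> of \<open>W_op \<alpha> j k l u\<close>, if \<open>u\<close> has the coefficients \<open>c\<close>.
  It comes from the part of degree \<open>m + 2\<close> of \<open>u\<close>: multiplication by \<open>z $ l\<close> makes up for the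
  second differentiation.
\<close>

definition W_part where
  "W_part \<alpha> j k l c m z =
     homogeneous_part (partial_deriv_coeffs k c) (Suc m) z
     + of_real \<alpha> * z $ l * homogeneous_part (partial_deriv_coeffs j (partial_deriv_coeffs k c)) m z"

lemma W_part_scale:
  "W_part \<alpha> j k l c m (\<zeta> *s z) = \<zeta> ^ Suc m * W_part \<alpha> j k l c m z"
  by (simp add: W_part_def homogeneous_part_scale algebra_simps)

lemma W_op_sums:
  assumes u: "homogeneous_expansion 2 c u" and z: "z \<in> unit_polydisk"
  shows "(\<lambda>m. W_part \<alpha> j k l c m z) sums W_op \<alpha> j k l u z"
proof -
  have 1: "homogeneous_expansion (Suc 0) (partial_deriv_coeffs k c) (dz k u)"
    using u by (intro homogeneous_expansion_dz) (simp add: numeral_2_eq_2)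
  have 2: "homogeneous_expansion 0 (partial_deriv_coeffs j (partial_deriv_coeffs k c)) (dz j (dz k u))"
    by (rule homogeneous_expansion_dz[OF 1])
  from 1 2 z show ?thesis
    unfolding W_part_def W_op_def homogeneous_expansion_def
    by (intro sums_add sums_mult) auto
qed

text \<open>
  The constant \<open>e\<close> will be \<open>0\<close> for \<open>g\<close> and \<open>1\<close> for \<open>h\<close>, the value at the origin of the
  expression in the defining condition.
\<close>

lemma W_op_sums_on_ray:
  assumes u: "homogeneous_expansion 2 c u" and z: "cmod \<zeta> * maxnorm z < 1"
  shows "(\<lambda>m. (case m of 0 \<Rightarrow> e | Suc m \<Rightarrow> W_part \<alpha> j k l c m z) * \<zeta> ^ m) sums
           (e + W_op \<alpha> j k l u (\<zeta> *s z))"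
proof -
  have "\<zeta> *s z \<in> unit_polydisk"
    using z by (simp add: unit_polydisk_def maxnorm_scale)
  from W_op_sums[OF u this]
  have "(\<lambda>m. W_part \<alpha> j k l c m z * \<zeta> ^ Suc m) sums W_op \<alpha> j k l u (\<zeta> *s z)"
    by (simp only: W_part_scale mult.commute)
  thus ?thesis
    by (subst (asm) sums_Suc_iff[where f = "\<lambda>m. (case m of 0 \<Rightarrow> e | Suc m \<Rightarrow> W_part \<alpha> j k l c m z) * \<zeta> ^ m", simplified nat.case])
       (simp add: add.commute)
qed

text \<open>
  The coefficient bound that carries the theorem. Here \<open>u\<close> is \<open>h\<close> without its linear part,
  which contributes the constant \<open>1\<close>; that constant is the mean value of the right-hand side of
  \<open>W\<close> over every circle centred at the origin.
\<close>

lemma norm_W_part_le_1: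
  assumes u: "homogeneous_expansion 2 a u" and g: "homogeneous_expansion 2 b g"
    and z: "z \<in> unit_polydisk"
    and W: "\<And>z. z \<in> unit_polydisk \<Longrightarrow> cmod (W_op \<alpha> j k l g z) < Re (1 + W_op \<alpha> j k l u z)"
  shows "cmod (W_part \<alpha> j k l b m z) \<le> 1"
proof -
  obtain R where R: "R > 1" and ray: "\<And>\<zeta>. cmod \<zeta> < R \<Longrightarrow> cmod \<zeta> * maxnorm z < 1"
    using polydisk_ray_beyond_unit_circle[of z] z unfolding unit_polydisk_def by blast
  have "cmod (case Suc m of 0 \<Rightarrow> 0 | Suc m \<Rightarrow> W_part \<alpha> j k l b m z)
      \<le> Re (case 0 of 0 \<Rightarrow> 1 | Suc m \<Rightarrow> W_part \<alpha> j k l a m z)"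
  proof (rule norm_coeff_le_Re_constant_term[OF R W_op_sums_on_ray[OF g ray] W_op_sums_on_ray[OF u ray]])
    show "cmod (0 + W_op \<alpha> j k l g (\<zeta> *s z)) \<le> Re (1 + W_op \<alpha> j k l u (\<zeta> *s z))"
      if "cmod \<zeta> = 1" for \<zeta>
      using W[of "\<zeta> *s z"] that z by (simp add: unit_polydisk_def maxnorm_scale)
  qed
  thus ?thesis by simp
qed

lemma dz_partial_sum:
  fixes c :: "('n::finite \<Rightarrow> nat) \<Rightarrow> complex"
  shows "dz k (\<lambda>z. \<Sum>m<N. homogeneous_part c (m + Suc d) z)
     = (\<lambda>z. \<Sum>m<N. homogeneous_part (partial_deriv_coeffs k c) (m + d) z)"
proof (rule ext, rule dz_eqI, rule DERIV_sum)
  fix z :: "complex ^ 'n" and m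
  show "((\<lambda>s. homogeneous_part c (m + Suc d) (z + axis k s)) has_field_derivative
           homogeneous_part (partial_deriv_coeffs k c) (m + d) z) (at 0)"
    using homogeneous_part_has_derivative_axis[of c "m + d" z k 0] by simp
qed

lemma W_op_section_from2:
  fixes b :: "('n::finite \<Rightarrow> nat) \<Rightarrow> complex"
  shows "W_op \<alpha> j k l (section_from2 b q) z = (\<Sum>m<q - 1. W_part \<alpha> j k l b m z)"
proof -
  have "section_from2 b q = (\<lambda>z. \<Sum>m<q - 1. homogeneous_part b (m + Suc (Suc 0)) z)"
  proof
    fix z :: "complex ^ 'n"
    show "section_from2 b q z = (\<Sum>m<q - 1. homogeneous_part b (m + Suc (Suc 0)) z)"
      unfolding section_from2_def
      by (rule sum.reindex_bij_witness[where i = "\<lambda>m. m + 2" and j = "\<lambda>m. m - 2"])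
         (auto dest!: le_Suc_ex)
  qed
  thus ?thesis
    by (simp only: W_op_def dz_partial_sum)
       (simp add: W_part_def sum.distrib sum_distrib_left)
qed

lemma section1_add_axis: "section1 (z + axis k s) = section1 z + s"
  by (simp add: section1_def sum.distrib axis_def)

lemma W_op_section1: "W_op \<alpha> j k l section1 z = 1"
proof -
  have "dz k section1 w = 1" for w
    by (rule dz_eqI) (auto simp: section1_add_axis intro!: derivative_eq_intros)
  hence "dz k section1 = (\<lambda>_. 1)" by blast
  moreover have "dz j (\<lambda>_. 1) z = 0"
    by (rule dz_eqI) simp
  ultimately show ?thesis by (simp add: W_op_def)
qed

text \<open>
  Splitting off the linear part of \<open>h\<close> leaves a function whose expansion starts in degree \<open>2\<close>,
  as that of \<open>g\<close> does.
\<close>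

lemma W_op_eq_1_plus:
  assumes u: "homogeneous_expansion 2 a (\<lambda>z. h z - section1 z)" and z: "z \<in> unit_polydisk"
  shows "W_op \<alpha> j k l h z = 1 + W_op \<alpha> j k l (\<lambda>z. h z - section1 z) z"
proof -
  let ?u = "\<lambda>z. h z - section1 z"
  have u2: "homogeneous_expansion (Suc (Suc 0)) a ?u"
    using u by (simp add: numeral_2_eq_2)
  have 1: "dz k h w = 1 + dz k ?u w" if "w \<in> unit_polydisk" for w
  proof (rule dz_eqI)
    have "((\<lambda>s. ?u (w + axis k s) + (section1 w + s)) has_field_derivative dz k ?u w + 1) (at 0)"
      by (rule DERIV_add[OF homogeneous_expansion_has_derivative[OF u2 that]])
         (auto intro!: derivative_eq_intros)
    thus "((\<lambda>s. h (w + axis k s)) has_field_derivative 1 + dz k ?u w) (at 0)"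
      by (simp add: section1_add_axis add.commute)
  qed
  have "dz j (dz k h) z = dz j (\<lambda>w. 1 + dz k ?u w) z"
    by (rule dz_cong[OF open_unit_polydisk z 1])
  also have "\<dots> = dz j (dz k ?u) z"
    using DERIV_add[OF DERIV_const[of 1]
        homogeneous_expansion_has_derivative[OF homogeneous_expansion_dz[OF u2] z, of k j]]
    by (intro dz_eqI) simp
  finally show ?thesis
    using 1[OF z] by (simp add: W_op_def)
qed

section \<open>The bound for the section of \<open>g\<close>\<close>

lemma sum_half_powers: "(\<Sum>m<N. (1 / 2) ^ Suc m) = 1 - (1 / 2 :: real) ^ N"
  by (induction N) simp_all

theorem theorem4p1:
  fixes f h g :: "complex ^ 'n \<Rightarrow> complex"
    and a b :: "('n \<Rightarrow> nat) \<Rightarrow> complex"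
    and \<alpha> :: real and q :: nat
  assumes "\<alpha> \<ge> 0"
    and "f \<in> class_W \<alpha>"
    and "canonical_decomp f h g"
    and "\<And>z. z \<in> unit_polydisk \<Longrightarrow>
           (\<lambda>m. homogeneous_part a (m + 2) z) sums (h z - (\<Sum>j\<in>UNIV. z $ j))"
    and "\<And>z. z \<in> unit_polydisk \<Longrightarrow>
           (\<lambda>m. homogeneous_part b (m + 2) z) sums g z"
    and "q \<ge> 2"
  shows "\<forall>z :: complex ^ 'n. maxnorm z < 1 / (2 * real CARD('n) ^ 5) \<longrightarrow>
           W_condition \<alpha> section1 (section_from2 b q) z"
proof (intro allI impI)
  fix z :: "complex ^ 'n"
  assume z: "maxnorm z < 1 / (2 * real CARD('n) ^ 5)"
  let ?u = "\<lambda>z. h z - section1 z"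
  have hol: "mv_holomorphic_on h unit_polydisk" "mv_holomorphic_on g unit_polydisk"
    using assms(3) by (auto simp: canonical_decomp_def)
  have "mv_holomorphic_on section1 (unit_polydisk :: (complex ^ 'n) set)"
    unfolding mv_holomorphic_on_def section1_def
  proof (intro ballI exI[of _ "\<chi> i. 1"])
    fix w :: "complex ^ 'n"
    have "((\<lambda>z. \<Sum>k\<in>UNIV. z $ k) has_derivative (\<lambda>v. \<Sum>i\<in>UNIV. v $ i)) (at w)"
      by (intro has_derivative_sum bounded_linear_imp_has_derivative bounded_linear_vec_nth)
    thus "((\<lambda>z. \<Sum>k\<in>UNIV. z $ k) has_derivative (\<lambda>v. \<Sum>i\<in>UNIV. (\<chi> i. 1) $ i * v $ i)) (at w)"
      by simp
  qed
  with hol(1) have "mv_holomorphic_on ?u unit_polydisk"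
    by (rule mv_holomorphic_on_diff)
  hence u: "homogeneous_expansion 2 a ?u"
    using assms(4) by (intro mv_holomorphic_imp_homogeneous_expansion) (auto simp only: section1_def)
  have g: "homogeneous_expansion 2 b g"
    using hol(2) assms(5) by (intro mv_holomorphic_imp_homogeneous_expansion)
  have W: "cmod (W_op \<alpha> j k l g w) < Re (1 + W_op \<alpha> j k l ?u w)" if w: "w \<in> unit_polydisk" for j k l w
  proof -
    obtain h' g' where hg': "canonical_decomp f h' g'" "W_condition \<alpha> h' g' w"
      using assms(2) w by (auto simp: class_W_def)
    note eq = canonical_decomp_unique[OF assms(3) hg'(1)]
    have "W_op \<alpha> j k l h w = W_op \<alpha> j k l h' w" "W_op \<alpha> j k l g w = W_op \<alpha> j k l g' w"
      unfolding W_op_def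
      using dz_cong[OF open_unit_polydisk w eq(1)] dz_cong[OF open_unit_polydisk w eq(2)]
        dz_dz_cong[OF open_unit_polydisk w eq(1)] dz_dz_cong[OF open_unit_polydisk w eq(2)] by simp_all
    with hg'(2) W_op_eq_1_plus[OF u w, of \<alpha> j k l] show ?thesis
      by (metis W_condition_iff)
  qed
  have "1 / (2 * real CARD('n) ^ 5) \<le> 1 / 2"
    by (simp add: field_simps)
  hence "maxnorm z < 1 / 2"
    using z by linarith
  hence "2 *s z \<in> unit_polydisk"
    by (simp add: unit_polydisk_def maxnorm_scale)
  have "cmod (W_op \<alpha> j k l (section_from2 b q) z) < 1" for j k l
  proof -
    \<comment> \<open>The bound \<open>1\<close> at the point \<open>2 *s z\<close> of the polydisk, scaled back to \<open>z\<close>.\<close>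
    have "cmod (W_part \<alpha> j k l b m z) \<le> (1 / 2) ^ Suc m" for m
    proof -
      have "z = of_real (1 / 2) *s (2 *s z)"
        by (simp add: vector_smult_assoc)
      hence "W_part \<alpha> j k l b m z = of_real (1 / 2) ^ Suc m * W_part \<alpha> j k l b m (2 *s z)"
        by (metis W_part_scale)
      hence "cmod (W_part \<alpha> j k l b m z) = (1 / 2) ^ Suc m * cmod (W_part \<alpha> j k l b m (2 *s z))"
        by (simp add: norm_mult norm_power norm_divide del: power_Suc)
      also have "\<dots> \<le> (1 / 2) ^ Suc m * 1"
        by (intro mult_left_mono norm_W_part_le_1[OF u g \<open>2 *s z \<in> unit_polydisk\<close> W]) simp_all
      finally show ?thesis by simp
    qed
    hence "cmod (W_op \<alpha> j k l (section_from2 b q) z) \<le> (\<Sum>m<q - 1. (1 / 2) ^ Suc m)"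
      unfolding W_op_section_from2 by (intro sum_norm_le)
    also have "\<dots> = 1 - (1 / 2) ^ (q - 1)"
      by (rule sum_half_powers)
    also have "\<dots> < 1" by simp
    finally show ?thesis .
  qed
  thus "W_condition \<alpha> section1 (section_from2 b q) z"
    by (simp add: W_condition_iff W_op_section1)
qed

end
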